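(* Let $N\in\mathbb{N}$ and let $A\subset\mathbb{R}^N$ be a set that is not relatively compact in $\mathbb{R}^N$. Then the set $nBC^\infty I(A)=\{f\in X : f \text{ is unbounded in } A\}$ is pointwise $\mathfrak{c}$-spaceable in $(X,d_X)$.
   Context: Let $X:=C^\infty(\mathbb{R}^N)\cap\bigcap_{p\ge 1}L^p(\mathbb{R}^N)$, i.e. the vector space of all infinitely differentiable functions $f:\mathbb{R}^N\to\mathbb{R}$ that are $p$-integrable (Lebesgue) on $\mathbb{R}^N$ for every real $p\in[1,+\infty)$. For $m=1,2,\dots$ put $\|f\|_m=\max_{|\alpha|\le m}\sup_{\|x\|\le m}|D^\alpha f(x)|$ (multi-indices $\alpha\in(\mathbb{N}\cup\{0\})^N$, $\|x\|$ the Euclidean norm), and let $\|f\|_{L^p}$ be the usual $L^p(\mathbb{R}^N)$-norm. The space $X$ carries the metric $$d_X(f,g)=\sum_{m=1}^\infty\frac{1}{2^m}\frac{\|f-g\|_m}{1+\|f-g\|_m}+\sum_{p=1}^\infty\frac{1}{2^p}\frac{\|f-g\|_{L^p}}{1+\|f-g\|_{L^p}}.$$ $\mathfrak{c}$ is the cardinality of the continuum; dimensions are algebraic (cardinality of a Hamel basis). A subset $M$ of a topological vector space $X$ is pointwise $\alpha$-spaceable if for each $x\in M$ there is a closed vector subspace $W_x$ of $X$ with $\dim(W_x)=\alpha$ and $x\in W_x\subset M\cup\{0\}$. *)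

theory Defs
  imports "HOL-Analysis.Analysis"
begin

unbundle cardinal_syntax

subsection \<open>Partial derivatives and smooth functions on \<open>real ^ 'n\<close>\<close>

definition partial_deriv :: "'n::finite \<Rightarrow> (real ^ 'n \<Rightarrow> real) \<Rightarrow> real ^ 'n \<Rightarrow> real" where
  "partial_deriv i f = (\<lambda>x. frechet_derivative f (at x) (axis i 1))"

definition C_infinity :: "(real ^ 'n::finite \<Rightarrow> real) \<Rightarrow> bool" where
  "C_infinity f \<longleftrightarrow> (\<forall>js. foldr partial_deriv js f differentiable_on UNIV)"

text \<open>An arbitrary but fixed enumeration of the coordinates, used to order the partial
  derivatives that make up \<open>D\<^sup>\<alpha>\<close>. By symmetry of mixed partial derivatives its choice is
  irrelevant for smooth functions.\<close>

definition coords :: "'n::finite list" where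
  "coords = (SOME xs. distinct xs \<and> set xs = UNIV)"

definition multi_deriv :: "('n::finite \<Rightarrow> nat) \<Rightarrow> (real ^ 'n \<Rightarrow> real) \<Rightarrow> real ^ 'n \<Rightarrow> real" where
  "multi_deriv \<alpha> = foldr partial_deriv (concat (map (\<lambda>i. replicate (\<alpha> i) i) coords))"

definition C_norm :: "nat \<Rightarrow> (real ^ 'n::finite \<Rightarrow> real) \<Rightarrow> real" where
  "C_norm m f = (MAX \<alpha>\<in>{\<alpha>. (\<Sum>i\<in>UNIV. \<alpha> i) \<le> m}. SUP x\<in>cball 0 (real m). \<bar>multi_deriv \<alpha> f x\<bar>)"

definition Lp_norm :: "real \<Rightarrow> (real ^ 'n::finite \<Rightarrow> real) \<Rightarrow> real" where
  "Lp_norm p f = (LINT x|lborel. \<bar>f x\<bar> powr p) powr (1 / p)"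


subsection \<open>Auxiliary facts\<close>

lemma C_infinity_mixed: "C_infinity f \<Longrightarrow> C_infinity (foldr partial_deriv js f)"
  unfolding C_infinity_def by (metis foldr_append comp_apply)

lemma C_infinity_differentiable: "C_infinity f \<Longrightarrow> f differentiable (at x)"
  unfolding C_infinity_def differentiable_on_def by (metis UNIV_I foldr.simps(1) id_apply)

lemma C_infinity_continuous: "C_infinity f \<Longrightarrow> continuous_on S f"
  by (meson C_infinity_differentiable continuous_at_imp_continuous_on differentiable_imp_continuous_within)

lemma partial_deriv_lincomb:
  assumes "f differentiable (at x)" "g differentiable (at x)"
  shows "partial_deriv i (\<lambda>x. a * f x + b * g x) x = a * partial_deriv i f x + b * partial_deriv i g x"
proof -
  have "((\<lambda>x. a * f x + b * g x) has_derivative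
      (\<lambda>h. a * frechet_derivative f (at x) h + b * frechet_derivative g (at x) h)) (at x)"
    using assms by (intro has_derivative_add has_derivative_mult_right)
      (simp_all add: frechet_derivative_works)
  from frechet_derivative_at[OF this] show ?thesis
    unfolding partial_deriv_def by metis
qed

lemma mixed_lincomb:
  assumes "C_infinity f" "C_infinity g"
  shows "foldr partial_deriv js (\<lambda>x. a * f x + b * g x) =
    (\<lambda>x. a * foldr partial_deriv js f x + b * foldr partial_deriv js g x)"
proof (induction js)
  case (Cons i js)
  show ?case
    by (simp add: Cons partial_deriv_lincomb C_infinity_differentiable C_infinity_mixed assms
        fun_eq_iff)
qed simp

lemma C_infinity_lincomb:
  assumes "C_infinity f" "C_infinity g"
  shows "C_infinity (\<lambda>x. a * f x + b * g x)"
  unfolding C_infinity_def mixed_lincomb[OF assms]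
  using assms unfolding C_infinity_def by (auto intro!: derivative_intros)

lemma C_infinity_zero: "C_infinity (\<lambda>x. 0)"
proof -
  have "foldr partial_deriv js (\<lambda>x. 0) = (\<lambda>x. 0)" for js :: "'a list"
    by (induction js) (auto simp: partial_deriv_def)
  then show ?thesis by (simp add: C_infinity_def)
qed

lemma powr_convex_nonneg:
  fixes u v l p :: real
  assumes p: "p \<ge> 1" and uv: "u \<ge> 0" "v \<ge> 0" and l: "0 \<le> l" "l \<le> 1"
  shows "((1 - l) * u + l * v) powr p \<le> (1 - l) * u powr p + l * v powr p"
proof -
  have small: "t powr p \<le> t" if "0 \<le> t" "t \<le> 1" for t :: real
    using powr_mono'[of 1 p t] p that by (cases "t = 0") auto
  consider "u = 0" | "v = 0" | "u > 0" "v > 0" using uv by linarith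
  then show ?thesis
  proof cases
    case 1
    then show ?thesis
      using small[of l] l uv p by (auto simp: powr_mult intro!: mult_right_mono)
  next
    case 2
    then show ?thesis
      using small[of "1 - l"] l uv p by (auto simp: powr_mult intro!: mult_right_mono)
  next
    case 3
    then show ?thesis
      using convex_onD[OF powr_convex[OF p], of l u v] l by simp
  qed
qed

lemma integrable_powr_lincomb:
  fixes f g :: "real ^ 'n::finite \<Rightarrow> real"
  assumes f: "continuous_on UNIV f" "integrable lborel (\<lambda>x. \<bar>f x\<bar> powr p)"
    and g: "continuous_on UNIV g" "integrable lborel (\<lambda>x. \<bar>g x\<bar> powr p)" and p: "p \<ge> 1"
  shows "integrable lborel (\<lambda>x. \<bar>a * f x + b * g x\<bar> powr p)"
proof (rule Bochner_Integration.integrable_bound)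
  let ?h = "\<lambda>x. 1/2 * (\<bar>2 * a\<bar> powr p * \<bar>f x\<bar> powr p) + 1/2 * (\<bar>2 * b\<bar> powr p * \<bar>g x\<bar> powr p)"
  show "integrable lborel ?h"
    using f g by (intro Bochner_Integration.integrable_add integrable_mult_right) auto
  have [measurable]: "f \<in> borel_measurable borel" "g \<in> borel_measurable borel"
    using f g by (auto intro: borel_measurable_continuous_onI)
  show "(\<lambda>x. \<bar>a * f x + b * g x\<bar> powr p) \<in> borel_measurable lborel"
    by measurable
  show "AE x in lborel. norm (\<bar>a * f x + b * g x\<bar> powr p) \<le> norm (?h x)"
  proof (rule AE_I2)
    fix x
    have "\<bar>a * f x + b * g x\<bar> powr p \<le> ((1 - 1/2) * \<bar>2 * a * f x\<bar> + 1/2 * \<bar>2 * b * g x\<bar>) powr p"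
      using p abs_triangle_ineq[of "a * f x" "b * g x"] by (intro powr_mono2) (auto simp: abs_mult)
    also have "\<dots> \<le> (1 - 1/2) * \<bar>2 * a * f x\<bar> powr p + 1/2 * \<bar>2 * b * g x\<bar> powr p"
      using p by (intro powr_convex_nonneg) auto
    also have "\<dots> = ?h x"
      by (simp add: abs_mult powr_mult)
    finally show "norm (\<bar>a * f x + b * g x\<bar> powr p) \<le> norm (?h x)"
      by simp
  qed
qed

lemma Lp_norm_nonneg: "0 \<le> Lp_norm p f"
  by (simp add: Lp_norm_def)

lemma Lp_norm_le_iff:
  assumes "c > 0" "p \<ge> 1"
  shows "Lp_norm p f \<le> c \<longleftrightarrow> (LINT x|lborel. \<bar>f x\<bar> powr p) \<le> c powr p"
proof -
  define I where "I = (LINT x|lborel. \<bar>f x\<bar> powr p)"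
  have I: "I \<ge> 0" unfolding I_def by (rule integral_nonneg_AE) auto
  have "I powr (1/p) \<le> c \<longleftrightarrow> I powr (1/p) \<le> (c powr p) powr (1/p)"
    using assms by (simp add: powr_powr)
  also have "\<dots> \<longleftrightarrow> I \<le> c powr p"
    using assms I by (meson powr_mono2 powr_less_mono2 linorder_not_le divide_pos_pos
        less_imp_le less_le_trans powr_ge_zero zero_less_one)
  finally show ?thesis by (simp add: Lp_norm_def I_def)
qed

lemma Lp_norm_triangle:
  fixes f g :: "real ^ 'n::finite \<Rightarrow> real"
  assumes f: "continuous_on UNIV f" "integrable lborel (\<lambda>x. \<bar>f x\<bar> powr p)"
    and g: "continuous_on UNIV g" "integrable lborel (\<lambda>x. \<bar>g x\<bar> powr p)" and p: "p \<ge> 1"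
  shows "Lp_norm p (\<lambda>x. f x + g x) \<le> Lp_norm p f + Lp_norm p g"
proof (rule field_le_epsilon)
  fix e :: real assume e: "e > 0"
  define a where "a = Lp_norm p f + e / 2"
  define b where "b = Lp_norm p g + e / 2"
  have a: "a > 0" and b: "b > 0"
    using e Lp_norm_nonneg[of p f] Lp_norm_nonneg[of p g] by (auto simp: a_def b_def)
  have Ia: "(LINT x|lborel. \<bar>f x\<bar> powr p) \<le> a powr p"
    using Lp_norm_le_iff[OF a p, of f] e by (simp add: a_def)
  have Ib: "(LINT x|lborel. \<bar>g x\<bar> powr p) \<le> b powr p"
    using Lp_norm_le_iff[OF b p, of g] e by (simp add: b_def)
  define l where "l = b / (a + b)"
  have l: "0 \<le> l" "l \<le> 1" using a b by (auto simp: l_def)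
  have al: "(1 - l) * (t / a) = t / (a + b)" "l * (t / b) = t / (a + b)" for t
    using a b by (auto simp: l_def field_simps)
  let ?h = "\<lambda>x. (a + b) powr p *
      ((1 - l) / a powr p * \<bar>f x\<bar> powr p + l / b powr p * \<bar>g x\<bar> powr p)"
  have le: "\<bar>f x + g x\<bar> powr p \<le> ?h x" for x
  proof -
    have "\<bar>f x + g x\<bar> powr p \<le> ((a + b) * ((1 - l) * (\<bar>f x\<bar> / a) + l * (\<bar>g x\<bar> / b))) powr p"
      unfolding al add_divide_distrib[symmetric] using a b p
      by (intro powr_mono2) (simp_all add: abs_triangle_ineq)
    also have "\<dots> = (a + b) powr p * ((1 - l) * (\<bar>f x\<bar> / a) + l * (\<bar>g x\<bar> / b)) powr p"
      by (rule powr_mult)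
    also have "\<dots> \<le> (a + b) powr p * ((1 - l) * (\<bar>f x\<bar> / a) powr p + l * (\<bar>g x\<bar> / b) powr p)"
      using a b l p by (intro mult_left_mono powr_convex_nonneg) auto
    also have "\<dots> = ?h x"
      using a b by (simp add: powr_divide)
    finally show ?thesis .
  qed
  have "(LINT x|lborel. \<bar>f x + g x\<bar> powr p) \<le> (LINT x|lborel. ?h x)"
  proof (rule integral_mono)
    show "integrable lborel (\<lambda>x. \<bar>f x + g x\<bar> powr p)"
      using integrable_powr_lincomb[OF f g p, of 1 1] by simp
    show "integrable lborel ?h"
      using f g by (intro Bochner_Integration.integrable_add integrable_mult_right) auto
  qed (use le in auto)
  also have "\<dots> = (a + b) powr p * ((1 - l) / a powr p * (LINT x|lborel. \<bar>f x\<bar> powr p)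
      + l / b powr p * (LINT x|lborel. \<bar>g x\<bar> powr p))"
    using f g by simp
  also have "\<dots> \<le> (a + b) powr p * ((1 - l) / a powr p * a powr p + l / b powr p * b powr p)"
    using Ia Ib l by (intro mult_left_mono add_mono) auto
  also have "\<dots> = (a + b) powr p"
    using a b by simp
  finally have "Lp_norm p (\<lambda>x. f x + g x) \<le> a + b"
    using Lp_norm_le_iff[of "a + b" p "\<lambda>x. f x + g x"] a b p by simp
  then show "Lp_norm p (\<lambda>x. f x + g x) \<le> Lp_norm p f + Lp_norm p g + e"
    by (simp add: a_def b_def)
qed

lemma finite_multi_indices: "finite {\<alpha> :: 'n::finite \<Rightarrow> nat. (\<Sum>i\<in>UNIV. \<alpha> i) \<le> m}"
proof (rule finite_subset)
  show "{\<alpha> :: 'n \<Rightarrow> nat. (\<Sum>i\<in>UNIV. \<alpha> i) \<le> m} \<subseteq> PiE UNIV (\<lambda>_. {..m})"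
    by (auto simp: PiE_UNIV_domain) (meson UNIV_I finite_code le_trans member_le_sum zero_le)
qed (auto intro!: finite_PiE)

lemma bdd_above_multi_deriv:
  "C_infinity f \<Longrightarrow> bdd_above ((\<lambda>x. \<bar>multi_deriv \<alpha> f x\<bar>) ` cball 0 r)"
  unfolding multi_deriv_def
  by (intro bounded_imp_bdd_above compact_imp_bounded compact_continuous_image
      continuous_on_rabs C_infinity_continuous C_infinity_mixed) auto

lemma C_norm_upper:
  fixes f :: "real ^ 'n::finite \<Rightarrow> real"
  assumes "C_infinity f" "(\<Sum>i\<in>UNIV. \<alpha> i) \<le> m" "norm x \<le> real m"
  shows "\<bar>multi_deriv \<alpha> f x\<bar> \<le> C_norm m f"
proof -
  have "\<bar>multi_deriv \<alpha> f x\<bar> \<le> (SUP x\<in>cball 0 (real m). \<bar>multi_deriv \<alpha> f x\<bar>)"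
    using assms by (intro cSUP_upper bdd_above_multi_deriv) auto
  also have "\<dots> \<le> C_norm m f"
    unfolding C_norm_def using assms finite_multi_indices[of m] by (intro Max_ge) auto
  finally show ?thesis .
qed

lemma C_norm_least:
  fixes f :: "real ^ 'n::finite \<Rightarrow> real"
  assumes "\<And>\<alpha> x. (\<Sum>i\<in>UNIV. \<alpha> i) \<le> m \<Longrightarrow> norm x \<le> real m \<Longrightarrow> \<bar>multi_deriv \<alpha> f x\<bar> \<le> c"
  shows "C_norm m f \<le> c"
proof -
  have "(\<lambda>_. 0) \<in> {\<alpha> :: 'n \<Rightarrow> nat. (\<Sum>i\<in>UNIV. \<alpha> i) \<le> m}" by simp
  then have ne: "{\<alpha> :: 'n \<Rightarrow> nat. (\<Sum>i\<in>UNIV. \<alpha> i) \<le> m} \<noteq> {}" by blast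
  show ?thesis
    unfolding C_norm_def using ne finite_multi_indices[of m, where 'n='n] assms
    by (auto intro!: cSUP_least)
qed

lemma C_norm_nonneg:
  fixes f :: "real ^ 'n::finite \<Rightarrow> real"
  assumes "C_infinity f" shows "0 \<le> C_norm m f"
  using C_norm_upper[OF assms, of "\<lambda>_. 0" m 0] by simp

lemma C_norm_lincomb:
  fixes f g :: "real ^ 'n::finite \<Rightarrow> real"
  assumes f: "C_infinity f" and g: "C_infinity g"
  shows "C_norm m (\<lambda>x. a * f x + b * g x) \<le> \<bar>a\<bar> * C_norm m f + \<bar>b\<bar> * C_norm m g"
proof (rule C_norm_least)
  fix \<alpha> :: "'n \<Rightarrow> nat" and x :: "real ^ 'n" assume *: "(\<Sum>i\<in>UNIV. \<alpha> i) \<le> m" "norm x \<le> real m"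
  have "\<bar>multi_deriv \<alpha> (\<lambda>x. a * f x + b * g x) x\<bar>
      \<le> \<bar>a\<bar> * \<bar>multi_deriv \<alpha> f x\<bar> + \<bar>b\<bar> * \<bar>multi_deriv \<alpha> g x\<bar>"
    unfolding multi_deriv_def mixed_lincomb[OF f g]
    by (rule order_trans[OF abs_triangle_ineq]) (simp add: abs_mult)
  also have "\<dots> \<le> \<bar>a\<bar> * C_norm m f + \<bar>b\<bar> * C_norm m g"
    using C_norm_upper[OF f *] C_norm_upper[OF g *] by (intro add_mono mult_left_mono) auto
  finally show "\<bar>multi_deriv \<alpha> (\<lambda>x. a * f x + b * g x) x\<bar> \<le> \<bar>a\<bar> * C_norm m f + \<bar>b\<bar> * C_norm m g" .
qed


subsection \<open>The metric vector space \<open>X\<close>\<close>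

typedef (overloaded) 'n X =
  "{f :: real ^ 'n::finite \<Rightarrow> real.
     C_infinity f \<and> (\<forall>p\<ge>1. integrable lborel (\<lambda>x. \<bar>f x\<bar> powr p))}"
  morphisms fun_of Abs_X
  by (rule exI[of _ "\<lambda>x. 0"]) (auto simp: C_infinity_zero)

setup_lifting type_definition_X

instantiation X :: (finite) real_vector
begin

lift_definition zero_X :: "'a X" is "\<lambda>x. 0"
  by (auto simp: C_infinity_zero)

lift_definition plus_X :: "'a X \<Rightarrow> 'a X \<Rightarrow> 'a X" is "\<lambda>f g x. f x + g x"
  subgoal for f g
    using C_infinity_lincomb[of f g 1 1] integrable_powr_lincomb[of f _ g 1 1]
    by (auto simp: C_infinity_continuous)
  done

lift_definition scaleR_X :: "real \<Rightarrow> 'a X \<Rightarrow> 'a X" is "\<lambda>c f x. c * f x"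
  subgoal for c f
    using C_infinity_lincomb[of f f c 0] integrable_powr_lincomb[of f _ f c 0]
    by (auto simp: C_infinity_continuous)
  done

lift_definition uminus_X :: "'a X \<Rightarrow> 'a X" is "\<lambda>f x. - f x"
  subgoal for f
    using C_infinity_lincomb[of f f "-1" 0] integrable_powr_lincomb[of f _ f "-1" 0]
    by (auto simp: C_infinity_continuous)
  done

lift_definition minus_X :: "'a X \<Rightarrow> 'a X \<Rightarrow> 'a X" is "\<lambda>f g x. f x - g x"
  subgoal for f g
    using C_infinity_lincomb[of f g 1 "-1"] integrable_powr_lincomb[of f _ g 1 "-1"]
    by (auto simp: C_infinity_continuous)
  done

instance
  by standard (transfer; simp add: algebra_simps fun_eq_iff)+

end

lemma fun_of_C_infinity: "C_infinity (fun_of f)"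
  using fun_of[of f] by auto

lemma fun_of_integrable: "p \<ge> 1 \<Longrightarrow> integrable lborel (\<lambda>x. \<bar>fun_of f x\<bar> powr p)"
  using fun_of[of f] by auto

definition bounded_term :: "real \<Rightarrow> real" where
  "bounded_term t = t / (1 + t)"

lemma bounded_term_bounds: "0 \<le> t \<Longrightarrow> 0 \<le> bounded_term t \<and> bounded_term t \<le> 1"
  by (auto simp: bounded_term_def)

lemma bounded_term_eq_0: "0 \<le> t \<Longrightarrow> bounded_term t = 0 \<longleftrightarrow> t = 0"
  by (auto simp: bounded_term_def)

lemma bounded_term_subadd:
  assumes "0 \<le> r" "0 \<le> s" "0 \<le> t" "t \<le> r + s"
  shows "bounded_term t \<le> bounded_term r + bounded_term s"
proof -
  have "bounded_term t \<le> (r + s) / (1 + (r + s))"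
    using assms by (simp add: bounded_term_def field_simps)
  also have "\<dots> = r / (1 + (r + s)) + s / (1 + (r + s))"
    by (simp add: add_divide_distrib)
  also have "\<dots> \<le> bounded_term r + bounded_term s"
    unfolding bounded_term_def using assms by (intro add_mono divide_left_mono) auto
  finally show ?thesis .
qed

lemma summable_bounded_term:
  assumes "\<And>m. 0 \<le> q m"
  shows "summable (\<lambda>m. 1 / 2 ^ Suc m * bounded_term (q m))"
proof (rule summable_comparison_test')
  show "summable (\<lambda>m. (1 / 2) ^ Suc m :: real)"
    by (intro summable_Suc_iff[THEN iffD2] summable_geometric) auto
  show "norm (1 / 2 ^ Suc m * bounded_term (q m)) \<le> (1 / 2) ^ Suc m" for m
    using bounded_term_bounds[OF assms[of m]] by (simp add: power_one_over field_simps abs_mult)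
qed

lemma suminf_bounded_term_eq_0:
  assumes "\<And>m. 0 \<le> q m"
  shows "0 \<le> (\<Sum>m. 1 / 2 ^ Suc m * bounded_term (q m))"
    and "(\<Sum>m. 1 / 2 ^ Suc m * bounded_term (q m)) = 0 \<longleftrightarrow> (\<forall>m. q m = 0)"
proof -
  have nn: "0 \<le> 1 / 2 ^ Suc m * bounded_term (q m)" for m
    using bounded_term_bounds[OF assms[of m]] by simp
  show "0 \<le> (\<Sum>m. 1 / 2 ^ Suc m * bounded_term (q m))"
    by (rule suminf_nonneg[OF summable_bounded_term]) (use assms nn in auto)
  show "(\<Sum>m. 1 / 2 ^ Suc m * bounded_term (q m)) = 0 \<longleftrightarrow> (\<forall>m. q m = 0)"
    using suminf_eq_zero_iff[OF summable_bounded_term[of q], OF assms nn]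
      bounded_term_eq_0[OF assms] by simp
qed

lemma suminf_bounded_term_triangle:
  assumes "\<And>m. 0 \<le> q m" "\<And>m. 0 \<le> r m" "\<And>m. 0 \<le> s m" "\<And>m. q m \<le> r m + s m"
  shows "(\<Sum>m. 1 / 2 ^ Suc m * bounded_term (q m)) \<le>
    (\<Sum>m. 1 / 2 ^ Suc m * bounded_term (r m)) + (\<Sum>m. 1 / 2 ^ Suc m * bounded_term (s m))"
proof -
  have "1 / 2 ^ Suc m * bounded_term (q m) \<le>
      1 / 2 ^ Suc m * bounded_term (r m) + 1 / 2 ^ Suc m * bounded_term (s m)" for m
    unfolding distrib_left[symmetric]
    by (intro mult_left_mono bounded_term_subadd assms) auto
  then show ?thesis
    using summable_bounded_term[of q, OF assms(1)]
      summable_bounded_term[of r, OF assms(2)] summable_bounded_term[of s, OF assms(3)]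
    by (subst suminf_add) (auto simp del: power_Suc intro!: suminf_le summable_add)
qed

instantiation X :: (finite) metric_space
begin

text \<open>The series over \<open>m \<ge> 1\<close> and \<open>p \<ge> 1\<close> are indexed from 0 here, hence the successors.\<close>

definition dist_X :: "'a X \<Rightarrow> 'a X \<Rightarrow> real" where
  "dist_X f g =
     (\<Sum>m. 1 / 2 ^ Suc m * bounded_term (C_norm (Suc m) (fun_of (f - g)))) +
     (\<Sum>p. 1 / 2 ^ Suc p * bounded_term (Lp_norm (real (Suc p)) (fun_of (f - g))))"

definition uniformity_X :: "('a X \<times> 'a X) filter" where
  "uniformity_X = (INF e\<in>{0 <..}. principal {(x, y). dist x y < e})"

definition open_X :: "'a X set \<Rightarrow> bool" where
  "open_X U = (\<forall>x\<in>U. \<forall>\<^sub>F (x', y) in uniformity. x' = x \<longrightarrow> y \<in> U)"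

instance
proof
  fix f g h :: "'a X"
  have C0: "0 \<le> C_norm m (fun_of k)" for m and k :: "'a X"
    by (simp add: C_norm_nonneg fun_of_C_infinity)
  have L0: "0 \<le> Lp_norm p (fun_of k)" for p and k :: "'a X"
    by (rule Lp_norm_nonneg)
  show "dist f g = 0 \<longleftrightarrow> f = g"
  proof
    assume "dist f g = 0"
    then have "C_norm (Suc m) (fun_of (f - g)) = 0" for m
      using suminf_bounded_term_eq_0[of "\<lambda>m. C_norm (Suc m) (fun_of (f - g))", OF C0]
        suminf_bounded_term_eq_0[of "\<lambda>p. Lp_norm (real (Suc p)) (fun_of (f - g))", OF L0]
      by (auto simp: dist_X_def)
    then have "fun_of (f - g) x = 0" if "norm x \<le> real (Suc m)" for x m
      using C_norm_upper[OF fun_of_C_infinity[of "f - g"], of "\<lambda>_. 0" "Suc m" x] that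
      by (simp add: multi_deriv_def concat_eq_Nil_conv[THEN iffD2])
    then have "fun_of (f - g) x = 0" for x
      by (meson real_arch_simple of_nat_le_iff le_trans lessI less_imp_le order_trans)
    then show "f = g"
      by (simp add: minus_X.rep_eq fun_of_inject[symmetric] fun_eq_iff)
  next
    assume "f = g"
    then have z: "fun_of (f - g) = (\<lambda>x. 0)" by (simp add: zero_X.rep_eq)
    have "C_norm m (\<lambda>x :: real ^ 'a. 0) = 0" for m
      using C_norm_lincomb[OF C_infinity_zero[where 'a = 'a] C_infinity_zero, of m 0 0]
        C_norm_nonneg[OF C_infinity_zero[where 'a = 'a], of m]
      by simp
    then show "dist f g = 0"
      by (simp add: dist_X_def z Lp_norm_def bounded_term_def)
  qed
  have eq: "fun_of (f - g) = (\<lambda>x. fun_of (f - h) x + - 1 * fun_of (g - h) x)"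
    by (simp add: minus_X.rep_eq fun_eq_iff)
  have C: "C_norm m (fun_of (f - g)) \<le> C_norm m (fun_of (f - h)) + C_norm m (fun_of (g - h))" for m
    using C_norm_lincomb[OF fun_of_C_infinity fun_of_C_infinity, of m 1 "f - h" "- 1" "g - h"]
    unfolding eq by simp
  have L: "Lp_norm (real (Suc p)) (fun_of (f - g))
      \<le> Lp_norm (real (Suc p)) (fun_of (f - h)) + Lp_norm (real (Suc p)) (fun_of (g - h))" for p
  proof -
    have "Lp_norm (real (Suc p)) (\<lambda>x. fun_of (f - h) x + fun_of (h - g) x)
      \<le> Lp_norm (real (Suc p)) (fun_of (f - h)) + Lp_norm (real (Suc p)) (fun_of (h - g))"
      by (intro Lp_norm_triangle C_infinity_continuous fun_of_C_infinity fun_of_integrable) auto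
    moreover have "Lp_norm (real (Suc p)) (fun_of (h - g)) = Lp_norm (real (Suc p)) (fun_of (g - h))"
      by (simp add: Lp_norm_def minus_X.rep_eq abs_minus_commute)
    ultimately show ?thesis by (simp add: minus_X.rep_eq)
  qed
  show "dist f g \<le> dist f h + dist g h"
    unfolding dist_X_def
    using suminf_bounded_term_triangle[OF C0 C0 C0 C, of Suc] suminf_bounded_term_triangle[OF L0 L0 L0 L, of "\<lambda>p. p"]
    by linarith
qed (simp_all add: uniformity_X_def open_X_def)

end


subsection \<open>Pointwise spaceability\<close>

text \<open>Cardinals are represented by cardinal orders, so that \<open>|UNIV :: real set|\<close> is the
  continuum. The \<open>dim\<close> of the library is a natural number, which is useless here.\<close>

definition has_algebraic_dim :: "'a::real_vector set \<Rightarrow> 'k rel \<Rightarrow> bool" where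
  "has_algebraic_dim W \<kappa> \<longleftrightarrow> (\<exists>B. independent B \<and> span B = W \<and> |B| =o \<kappa>)"

definition pointwise_spaceable :: "'k rel \<Rightarrow> 'a::{real_vector, topological_space} set \<Rightarrow> bool" where
  "pointwise_spaceable \<kappa> M \<longleftrightarrow>
     (\<forall>x\<in>M. \<exists>W. subspace W \<and> closed W \<and> has_algebraic_dim W \<kappa> \<and> x \<in> W \<and> W \<subseteq> M \<union> {0})"

definition nBC_infty_I :: "(real ^ 'n::finite) set \<Rightarrow> 'n X set" where
  "nBC_infty_I A = {f. \<not> bounded (fun_of f ` A)}"

end

theory Submission
  imports Defs "HOL-Real_Asymp.Real_Asymp"
begin

text \<open>
  Let \<open>f \<in> X\<close> be unbounded on \<open>A\<close>. Being bounded on every ball, \<open>f\<close> is unbounded along a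
  sequence of points \<open>a k \<in> A\<close> whose norms grow by at least 2 in each step
  (\<open>escaping_sequence_exists\<close>). Around each \<open>a k\<close> place a smooth bump of height 1 whose support
  has radius at most \<open>1/2\<close> and shrinks geometrically. Distinct bumps live in distinct
  spherical shells, so \<^emph>\<open>every\<close> choice of heights gives a smooth function, and heights of
  polynomial growth give a function in all \<open>L\<^sup>p\<close>.

  Partition the indices into infinitely many infinite blocks. The space \<open>W\<close> consists of all
  elements of \<open>X\<close> of the form \<open>c 0 * f + \<Sum>n\<ge>1. c n * g n\<close>, where \<open>c\<close> is a real sequence and
  \<open>g n\<close> is the sum of the bumps in block \<open>n\<close>, the \<open>k\<close>-th one scaled to height \<open>k + 1\<close>. Block 0
  carries no bumps. The values at finitely many centres determine each coefficient:
  block 0 sees only \<open>f\<close> and gives \<open>c 0\<close>, after which one centre in block \<open>n\<close> gives \<open>c n\<close>.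
  Everything follows from this.

  \<^item> Evaluation at a point is continuous for \<open>d\<^sub>X\<close>, so the coefficients are continuous linear
    functionals, and \<open>W\<close> is closed because it is cut out by the equations that say that a
    function has, at each point, the value predicted by its coefficients
    (\<open>closed_expansions\<close>).
  \<^item> A nonzero element has a nonzero coefficient. If \<open>c 0 \<noteq> 0\<close> then the element is unbounded
    along block 0, just as \<open>f\<close> is; otherwise it is unbounded along a block \<open>n\<close> with \<open>c n \<noteq> 0\<close>
    (\<open>expansions_unbounded\<close>).
  \<^item> \<open>W\<close> embeds into the space of real sequences, which has the cardinality of the continuum.
    Conversely it contains the functions with coefficients \<open>c n = t ^ n\<close> for \<open>0 < t < 1\<close>, and
    these are linearly independent by a Vandermonde argument (\<open>dim_expansions\<close>).
\<close>

section \<open>Smooth functions built from the flat exponential\<close>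

text \<open>The factors \<open>1 / t ^ k\<close> are there to make the family closed under differentiation.\<close>

definition flat_exp :: "nat \<Rightarrow> real \<Rightarrow> real" where
  "flat_exp k t = (if t > 0 then exp (- 1 / t) / t ^ k else 0)"

lemma flat_exp_tendsto_0: "(flat_exp k \<longlongrightarrow> 0) (at 0)"
proof (rule filterlim_split_at_real)
  have "((\<lambda>t. inverse t ^ k / exp (inverse t)) \<longlongrightarrow> (0::real)) (at_right 0)"
    by (rule filterlim_compose[OF tendsto_power_div_exp_0 filterlim_inverse_at_top_right])
  then show "(flat_exp k \<longlongrightarrow> 0) (at_right 0)"
    by (rule Lim_transform_eventually)
      (auto simp: eventually_at_right_less flat_exp_def exp_minus divide_simps
        intro!: eventually_at_rightI[of 0 1])
  show "(flat_exp k \<longlongrightarrow> 0) (at_left 0)"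
    by (rule tendsto_eventually) (auto simp: flat_exp_def intro!: eventually_at_leftI[of "-1"])
qed

text \<open>At 0 the difference quotient of \<open>flat_exp k\<close> is \<open>flat_exp (k + 1)\<close>, so the derivative there
  is the limit computed above.\<close>
lemma flat_exp_has_derivative:
  "(flat_exp k has_real_derivative flat_exp (k + 2) t - real k * flat_exp (k + 1) t) (at t)"
proof -
  consider "t < 0" | "t = 0" | "t > 0" by linarith
  then show ?thesis
  proof cases
    case 1
    have "((\<lambda>t. 0) has_real_derivative 0) (at t)" by simp
    then have "(flat_exp k has_real_derivative 0) (at t)"
      by (rule has_field_derivative_transform_within_open[of _ _ _ "{..<0}"])
        (use 1 in \<open>auto simp: flat_exp_def\<close>)
    then show ?thesis using 1 by (simp add: flat_exp_def)
  next
    case 2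
    have "((\<lambda>h. (flat_exp k (0 + h) - flat_exp k 0) / h) \<longlongrightarrow> 0) (at 0)"
      by (rule Lim_transform_eventually[OF flat_exp_tendsto_0[of "Suc k"]])
        (auto simp: flat_exp_def eventually_at_filter)
    then show ?thesis
      using 2 by (simp add: DERIV_def flat_exp_def)
  next
    case 3
    have "((\<lambda>t. exp (- 1 / t) / t ^ k) has_real_derivative
        exp (- 1 / t) / t ^ (k + 2) - real k * (exp (- 1 / t) / t ^ (k + 1))) (at t)"
    proof (rule DERIV_cong[OF DERIV_divide[OF _ DERIV_pow]])
      show "((\<lambda>t. exp (- 1 / t)) has_real_derivative exp (- 1 / t) / t ^ 2) (at t)"
        using 3 by (auto intro!: derivative_eq_intros simp: power2_eq_square)
    qed (use 3 in \<open>cases k; simp add: field_simps power2_eq_square\<close>)+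
    then have "(flat_exp k has_real_derivative
        exp (- 1 / t) / t ^ (k + 2) - real k * (exp (- 1 / t) / t ^ (k + 1))) (at t)"
      by (rule has_field_derivative_transform_within_open[of _ _ _ "{0<..}"])
        (use 3 in \<open>auto simp: flat_exp_def\<close>)
    then show ?thesis using 3 by (simp add: flat_exp_def)
  qed
qed

text \<open>A class of functions that visibly contains its own partial derivatives, so that smoothness
  reduces to differentiability of its members. The flat exponential is
  applied to a squared distance, not a distance, because the inner derivative is then a polynomial.\<close>
inductive smooth_expr :: "(real ^ 'n::finite \<Rightarrow> real) \<Rightarrow> bool" where
  const: "smooth_expr (\<lambda>x. c)"
| coord: "smooth_expr (\<lambda>x. x $ i)"
| flat: "smooth_expr (\<lambda>x. flat_exp k (s - (x - a) \<bullet> (x - a)))"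
| add: "smooth_expr f \<Longrightarrow> smooth_expr g \<Longrightarrow> smooth_expr (\<lambda>x. f x + g x)"
| mult: "smooth_expr f \<Longrightarrow> smooth_expr g \<Longrightarrow> smooth_expr (\<lambda>x. f x * g x)"

lemma smooth_expr_has_derivative:
  "smooth_expr f \<Longrightarrow>
    \<exists>D. (\<forall>x. (f has_derivative D x) (at x)) \<and> (\<forall>i. smooth_expr (\<lambda>x. D x (axis i 1)))"
proof (induction rule: smooth_expr.induct)
  case (const c)
  show ?case
    by (rule exI[of _ "\<lambda>x h. 0"]) (auto intro: smooth_expr.const)
next
  case (coord i)
  show ?case
    by (rule exI[of _ "\<lambda>x h. h $ i"])
      (auto intro: smooth_expr.const bounded_linear_imp_has_derivative bounded_linear_vec_nth)
next
  case (flat k s a)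
  let ?q = "\<lambda>x. s - (x - a) \<bullet> (x - a)"
  let ?D = "\<lambda>x h. (flat_exp (k + 2) (?q x) + (- real k) * flat_exp (k + 1) (?q x)) * ((- 2) * ((x - a) \<bullet> h))"
  have "((\<lambda>x. flat_exp k (?q x)) has_derivative ?D x) (at x)" for x
    using DERIV_compose_FDERIV[OF flat_exp_has_derivative, of ?q "\<lambda>h. (- 2) * ((x - a) \<bullet> h)" x UNIV k]
    by (force intro!: derivative_eq_intros simp: inner_commute algebra_simps)
  moreover have "smooth_expr (\<lambda>x. ?D x (axis i 1))" for i
  proof -
    have "?D x (axis i 1) = (flat_exp (k + 2) (?q x) + (- real k) * flat_exp (k + 1) (?q x)) *
        ((- 2) * (x $ i + (- (a $ i))))" for x
      by (simp add: inner_axis)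
    then show ?thesis
      by (simp only:) (intro smooth_expr.intros)
  qed
  ultimately show ?case by (intro exI[of _ ?D]) blast
next
  case (add f g)
  then obtain D E where "\<And>x. (f has_derivative D x) (at x)" "\<And>i. smooth_expr (\<lambda>x. D x (axis i 1))"
    "\<And>x. (g has_derivative E x) (at x)" "\<And>i. smooth_expr (\<lambda>x. E x (axis i 1))" by blast
  then show ?case
    by (intro exI[of _ "\<lambda>x h. D x h + E x h"]) (auto intro!: has_derivative_add smooth_expr.add)
next
  case (mult f g)
  then obtain D E where "\<And>x. (f has_derivative D x) (at x)" "\<And>i. smooth_expr (\<lambda>x. D x (axis i 1))"
    "\<And>x. (g has_derivative E x) (at x)" "\<And>i. smooth_expr (\<lambda>x. E x (axis i 1))" by blast
  then show ?case using mult.hyps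
    by (intro exI[of _ "\<lambda>x h. f x * E x h + D x h * g x"])
      (auto intro!: has_derivative_mult smooth_expr.add smooth_expr.mult)
qed

lemma C_infinity_smooth_expr:
  assumes "smooth_expr f" shows "C_infinity f"
  unfolding C_infinity_def
proof
  fix js
  have "smooth_expr (foldr partial_deriv js f)"
  proof (induction js)
    case (Cons i js)
    obtain D where D: "\<And>x. (foldr partial_deriv js f has_derivative D x) (at x)"
      "smooth_expr (\<lambda>x. D x (axis i 1))"
      using smooth_expr_has_derivative[OF Cons] by blast
    have "partial_deriv i (foldr partial_deriv js f) = (\<lambda>x. D x (axis i 1))"
      unfolding partial_deriv_def frechet_derivative_at[OF D(1), symmetric] ..
    with D(2) show ?case by simp
  qed (use assms in simp)
  then show "foldr partial_deriv js f differentiable_on UNIV"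
    using smooth_expr_has_derivative
    by (metis differentiable_at_imp_differentiable_on differentiableI)
qed

text \<open>Iterated partial derivatives at a point only see a neighbourhood of that point.\<close>
lemma C_infinity_locally:
  fixes f :: "real ^ 'n::finite \<Rightarrow> real"
  assumes "\<And>x. \<exists>g U. C_infinity g \<and> open U \<and> x \<in> U \<and> (\<forall>y\<in>U. f y = g y)"
  shows "C_infinity f"
  unfolding C_infinity_def differentiable_on_def
proof (intro allI ballI)
  fix js :: "'n list" and x :: "real ^ 'n"
  obtain g U where g: "C_infinity g" and U: "open U" "x \<in> U" and eq: "\<And>y. y \<in> U \<Longrightarrow> f y = g y"
    using assms by blast
  have "foldr partial_deriv js f y = foldr partial_deriv js g y" if "y \<in> U" for y
    using that
  proof (induction js arbitrary: y)
    case (Cons i js)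
    have "(foldr partial_deriv js f has_derivative D) (at y) \<longleftrightarrow>
      (foldr partial_deriv js g has_derivative D) (at y)" for D
      using Cons U(1) by (auto elim!: has_derivative_transform_within_open)
    then have "frechet_derivative (foldr partial_deriv js f) (at y) =
      frechet_derivative (foldr partial_deriv js g) (at y)"
      unfolding frechet_derivative_def by presburger
    then show ?case unfolding partial_deriv_def foldr.simps comp_apply by (rule arg_cong)
  qed (simp add: eq)
  moreover have "foldr partial_deriv js g differentiable (at x)"
    using g by (intro C_infinity_differentiable C_infinity_mixed)
  ultimately show "foldr partial_deriv js f differentiable (at x)"
    using U unfolding differentiable_def by (metis has_derivative_transform_within_open)
qed

section \<open>Spaces of dimension continuum\<close>

text \<open>The Vandermonde determinant in disguise: subtracting \<open>s\<close> times the relation for \<open>n\<close> from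
  the relation for \<open>n + 1\<close> eliminates the node \<open>s\<close>.\<close>
lemma powers_independent:
  fixes \<alpha> :: "real \<Rightarrow> real"
  assumes "finite S" "\<And>n. (\<Sum>t\<in>S. \<alpha> t * t ^ n) = 0"
  shows "\<forall>t\<in>S. \<alpha> t = 0"
  using assms
proof (induction S arbitrary: \<alpha> rule: finite_induct)
  case (insert s S)
  have "(\<Sum>t\<in>S. (\<alpha> t * (t - s)) * t ^ n) = 0" for n
  proof -
    have "(\<Sum>t\<in>S. (\<alpha> t * (t - s)) * t ^ n) = (\<Sum>t\<in>insert s S. \<alpha> t * t ^ Suc n - s * (\<alpha> t * t ^ n))"
      using insert.hyps by (simp add: algebra_simps)
    also have "\<dots> = 0"
      unfolding sum_subtractf sum_distrib_left[symmetric] insert.prems by simp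
    finally show ?thesis .
  qed
  from insert.IH[OF this] have "\<forall>t\<in>S. \<alpha> t = 0"
    using insert.hyps by auto
  moreover from this have "\<alpha> s = 0"
    using insert.prems[of 0] insert.hyps by simp
  ultimately show ?case by simp
qed simp

lemma independent_of_power_coefficients:
  fixes L :: "nat \<Rightarrow> 'v::real_vector \<Rightarrow> real"
  assumes L: "\<And>n. linear (L n)" and e: "\<And>t n. t \<in> S \<Longrightarrow> L n (e t) = t ^ n"
  shows "inj_on e S" "independent (e ` S)"
proof -
  show inj: "inj_on e S"
    by (rule inj_onI) (metis e power_one_right)
  show "independent (e ` S)"
    unfolding independent_explicit_finite_subsets
  proof (intro allI impI)
    fix T u assume T: "T \<subseteq> e ` S" "finite T" and u: "(\<Sum>v\<in>T. u v *\<^sub>R v) = 0"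
    obtain S' where S': "S' \<subseteq> S" "finite S'" "T = e ` S'"
      using T finite_subset_image by metis
    have inj': "inj_on e S'" using inj S' inj_on_subset by blast
    have "(\<Sum>t\<in>S'. u (e t) * t ^ n) = 0" for n
    proof -
      have "0 = L n (\<Sum>t\<in>S'. u (e t) *\<^sub>R e t)"
        using u linear_0[OF L] unfolding S'(3) sum.reindex[OF inj'] by (simp add: o_def)
      also have "\<dots> = (\<Sum>t\<in>S'. u (e t) * t ^ n)"
        using S'(1) e by (auto simp: linear_sum[OF L] linear_cmul[OF L] subset_iff intro!: sum.cong)
      finally show ?thesis by simp
    qed
    from powers_independent[OF S'(2) this] show "\<forall>v\<in>T. u v = 0"
      using S'(3) by simp
  qed
qed

text \<open>A sequence of reals is determined by the rationals below each of its terms, hence by a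
  subset of a countable set.\<close>
lemma real_sequences_lepoll_reals: "(UNIV :: (nat \<Rightarrow> real) set) \<lesssim> (UNIV :: real set)"
proof -
  have "inj (\<lambda>s :: nat \<Rightarrow> real. {m. case from_nat m of (n, q) \<Rightarrow> real_of_rat q < s n})"
  proof (rule injI, rule ext)
    fix s s' :: "nat \<Rightarrow> real" and n
    assume eq: "{m. case from_nat m of (n, q) \<Rightarrow> real_of_rat q < s n} =
      {m. case from_nat m of (n, q) \<Rightarrow> real_of_rat q < s' n}"
    have "real_of_rat q < s n \<longleftrightarrow> real_of_rat q < s' n" for q
      using eq[THEN eqset_imp_iff, of "to_nat (n, q)"] by simp
    then show "s n = s' n"
      by (metis linorder_neq_iff of_rat_dense order_less_asym)
  qed
  then have "(UNIV :: (nat \<Rightarrow> real) set) \<lesssim> (UNIV :: nat set set)"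
    unfolding lepoll_def by blast
  also have "\<dots> \<approx> (UNIV :: real set)" by (rule nat_sets_eqpoll_reals)
  finally show ?thesis .
qed

text \<open>Separating coefficients bound the cardinality of any subset of \<open>W\<close>, in particular of a
  basis, by that of the real sequences; realising the geometric sequences as coefficients gives
  continuum many independent vectors.\<close>
lemma continuum_dim:
  fixes W :: "'v::real_vector set" and L :: "nat \<Rightarrow> 'v \<Rightarrow> real"
  assumes W: "subspace W" and L: "\<And>n. linear (L n)"
    and inj: "\<And>h h'. h \<in> W \<Longrightarrow> h' \<in> W \<Longrightarrow> (\<And>n. L n h = L n h') \<Longrightarrow> h = h'"
    and e: "\<And>t. 0 < t \<Longrightarrow> t < 1 \<Longrightarrow> e t \<in> W" "\<And>t n. 0 < t \<Longrightarrow> t < 1 \<Longrightarrow> L n (e t) = t ^ n"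
  shows "has_algebraic_dim W |UNIV :: real set|"
proof -
  let ?I = "{0<..<1::real}"
  note indep = independent_of_power_coefficients[of L ?I e, OF L]
  obtain B where B: "e ` ?I \<subseteq> B" "B \<subseteq> W" "independent B" "W \<subseteq> span B"
  proof (rule maximal_independent_subset_extend)
    show "e ` ?I \<subseteq> W" using e(1) by auto
    show "independent (e ` ?I)" using indep(2) e(2) by simp
  qed
  have "(UNIV :: real set) \<approx> ?I"
    by (simp add: open_interval_eqpoll_reals eqpoll_sym)
  also have "?I \<approx> e ` ?I"
    using indep(1) e by (auto intro!: inj_on_image_eqpoll_self[THEN eqpoll_sym])
  also have "e ` ?I \<lesssim> B" by (rule subset_imp_lepoll[OF B(1)])
  finally have ge: "(UNIV :: real set) \<lesssim> B" .
  have "inj_on (\<lambda>h n. L n h) B"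
    by (rule inj_onI) (metis inj B(2) subsetD)
  then have "B \<lesssim> (UNIV :: (nat \<Rightarrow> real) set)"
    unfolding lepoll_def by blast
  also have "\<dots> \<lesssim> (UNIV :: real set)" by (rule real_sequences_lepoll_reals)
  finally have "B \<approx> (UNIV :: real set)" using ge by (rule lepoll_antisym)
  moreover have "span B = W"
    using B W by (simp add: span_minimal subset_antisym)
  ultimately show ?thesis
    using B(3) unfolding has_algebraic_dim_def eqpoll_iff_card_of_ordIso by blast
qed

section \<open>Evaluation is continuous\<close>

lemma abs_eval_le_C_norm:
  assumes "C_infinity f" "norm x \<le> real m"
  shows "\<bar>f x\<bar> \<le> C_norm m f"
  using C_norm_upper[of f "\<lambda>_. 0" m x] assms
  by (simp add: multi_deriv_def concat_eq_Nil_conv[THEN iffD2])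

text \<open>A single term of the first series in the metric already controls the value at \<open>x\<close>.\<close>
lemma continuous_eval: "continuous_on UNIV (\<lambda>h :: 'n::finite X. fun_of h x)"
proof -
  obtain m where m: "norm x \<le> real (Suc m)"
    by (meson real_arch_simple of_nat_le_iff le_trans lessI less_imp_le order_trans)
  have C0: "0 \<le> C_norm m (fun_of k)" for m and k :: "'n X"
    by (simp add: C_norm_nonneg fun_of_C_infinity)
  have less: "\<bar>fun_of h x - fun_of g x\<bar> < \<epsilon>"
    if "\<epsilon> > 0" and d: "dist h g < 1 / 2 ^ Suc m * bounded_term \<epsilon>" for h g :: "'n X" and \<epsilon>
  proof -
    let ?q = "\<lambda>m. C_norm (Suc m) (fun_of (h - g))"
    have "1 / 2 ^ Suc m * bounded_term (?q m) \<le> (\<Sum>m. 1 / 2 ^ Suc m * bounded_term (?q m))"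
      using sum_le_suminf[OF summable_bounded_term[of ?q, OF C0], of "{m}"]
        bounded_term_bounds[OF C0] by simp
    also have "\<dots> \<le> dist h g"
      unfolding dist_X_def
      using suminf_bounded_term_eq_0(1)[of "\<lambda>p. Lp_norm (real (Suc p)) (fun_of (h - g))"]
      by (simp add: Lp_norm_nonneg)
    also note d
    finally have "bounded_term (?q m) < bounded_term \<epsilon>" by (simp add: divide_strict_right_mono field_simps)
    then have "?q m < \<epsilon>"
      using C0[of "Suc m" "h - g"] \<open>\<epsilon> > 0\<close> by (simp add: bounded_term_def divide_simps algebra_simps split: if_splits)
    with abs_eval_le_C_norm[OF fun_of_C_infinity m, of "h - g"] show ?thesis
      by (simp add: minus_X.rep_eq)
  qed
  show ?thesis
    unfolding continuous_on_iff dist_real_def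
  proof (intro ballI allI impI)
    fix g :: "'n X" and \<epsilon> :: real assume "\<epsilon> > 0"
    then show "\<exists>d>0. \<forall>h\<in>UNIV. dist h g < d \<longrightarrow> \<bar>fun_of h x - fun_of g x\<bar> < \<epsilon>"
      using less by (intro exI[of _ "1 / 2 ^ Suc m * bounded_term \<epsilon>"]) (auto simp: bounded_term_def)
  qed
qed

section \<open>Bumps along an escaping sequence\<close>

lemma summable_powr_div_exponential:
  "summable (\<lambda>k. (real k + 1) powr p / 2 ^ k)"
proof (rule summable_comparison_test_bigo)
  show "summable (\<lambda>k. norm (1 / real k ^ 2))"
    using inverse_power_summable[of 2, where 'a = real] by (simp add: inverse_eq_divide)
  show "(\<lambda>k. (real k + 1) powr p / 2 ^ k) \<in> O(\<lambda>k. 1 / real k ^ 2)"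
    by real_asymp
qed

text \<open>The gap 2 leaves room for bumps of radius at most \<open>1/2\<close> around the points and keeps
  any two of these bumps at distance at least 1.\<close>
locale escaping_sequence =
  fixes a :: "nat \<Rightarrow> real ^ 'n::finite"
  assumes norm_gap: "norm (a k) + 2 \<le> norm (a (Suc k))"
begin

definition radius :: "nat \<Rightarrow> real" where
  "radius k = (1 / 2) ^ Suc k"

definition bump :: "nat \<Rightarrow> real ^ 'n \<Rightarrow> real" where
  "bump k x = flat_exp 0 ((radius k)\<^sup>2 - (x - a k) \<bullet> (x - a k)) / flat_exp 0 ((radius k)\<^sup>2)"

lemma radius_bounds: "0 < radius k" "radius k \<le> 1 / 2"
  using power_le_one[of "1/2 :: real" k] by (simp_all add: radius_def)

lemma bump_center: "bump k (a k) = 1"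
  using radius_bounds(1)[of k] by (simp add: bump_def flat_exp_def)

lemma bump_bounds: "0 \<le> bump k x" "bump k x \<le> 1"
proof -
  have mono: "flat_exp 0 s \<le> flat_exp 0 t" if "s \<le> t" for s t
    using that by (auto simp: flat_exp_def divide_simps)
  have "0 < flat_exp 0 ((radius k)\<^sup>2)"
    using radius_bounds(1)[of k] by (simp add: flat_exp_def)
  moreover have "0 \<le> flat_exp 0 t" for t by (simp add: flat_exp_def)
  ultimately show "0 \<le> bump k x" "bump k x \<le> 1"
    using mono[of "(radius k)\<^sup>2 - (x - a k) \<bullet> (x - a k)" "(radius k)\<^sup>2"]
    by (simp_all add: bump_def)
qed

lemma bump_nonzero_imp:
  assumes "bump k x \<noteq> 0" shows "x \<in> ball (a k) (radius k)"
proof -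
  have "(norm (x - a k))\<^sup>2 < (radius k)\<^sup>2"
    using assms by (auto simp: bump_def flat_exp_def power2_norm_eq_inner split: if_splits)
  then have "norm (x - a k) < radius k"
    using radius_bounds(1)[of k] by (auto intro: power_less_imp_less_base[of _ 2])
  then show ?thesis
    by (simp add: dist_norm norm_minus_commute)
qed

lemma C_infinity_bump: "C_infinity (\<lambda>x. c * bump k x)"
proof -
  have "smooth_expr (\<lambda>x. c / flat_exp 0 ((radius k)\<^sup>2) *
      flat_exp 0 ((radius k)\<^sup>2 - (x - a k) \<bullet> (x - a k)))"
    by (intro smooth_expr.intros)
  from C_infinity_smooth_expr[OF this] show ?thesis
    by (simp add: bump_def)
qed

lemma norm_increasing: "k < l \<Longrightarrow> norm (a k) + 2 \<le> norm (a l)"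
proof (induction l)
  case (Suc l)
  then show ?case using norm_gap[of l] by (cases "k = l") auto
qed simp

text \<open>Stated for two points at distance less than 1 rather than for one common point, so that it
  gives local finiteness of the bumps as well as their disjointness.\<close>
lemma balls_far_apart:
  assumes y: "y \<in> ball (a k) (radius k)" and z: "z \<in> ball (a l) (radius l)" and yz: "dist y z < 1"
  shows "k = l"
proof (rule ccontr)
  assume "k \<noteq> l"
  then have "2 \<le> \<bar>norm (a k) - norm (a l)\<bar>"
    using norm_increasing[of k l] norm_increasing[of l k] by linarith
  also have "\<dots> \<le> dist (a k) (a l)"
    by (simp add: dist_norm norm_triangle_ineq3)
  also have "\<dots> \<le> dist (a k) y + dist y z + dist z (a l)"
    using dist_triangle[of "a k" "a l" y] dist_triangle[of y "a l" z] by linarith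
  also have "\<dots> < 2"
    using y z yz radius_bounds(2)[of k] radius_bounds(2)[of l] by (simp add: dist_commute)
  finally show False by simp
qed

lemma bump_zero_on_other_ball:
  assumes "x \<in> ball (a k) (radius k)" "l \<noteq> k" shows "bump l x = 0"
proof (rule ccontr)
  assume "bump l x \<noteq> 0"
  from balls_far_apart[OF bump_nonzero_imp[OF this] assms(1)] show False
    using assms(2) by (simp del: mem_ball)
qed

text \<open>This is \<open>\<Sum>k. b k * bump k x\<close>. At most one term is nonzero, and its index does not depend
  on \<open>b\<close>; selecting it directly makes linearity in \<open>b\<close> immediate. Where all bumps vanish, the
  selected index is arbitrary and the value is 0.\<close>
definition superposition :: "(nat \<Rightarrow> real) \<Rightarrow> real ^ 'n \<Rightarrow> real" where
  "superposition b x = (let k = (SOME k. bump k x \<noteq> 0) in b k * bump k x)"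

lemma superposition_eq:
  assumes "\<And>l. l \<noteq> k \<Longrightarrow> bump l x = 0"
  shows "superposition b x = b k * bump k x"
proof (cases "\<exists>l. bump l x \<noteq> 0")
  case True
  then have "bump (SOME l. bump l x \<noteq> 0) x \<noteq> 0" by (rule someI_ex)
  with assms have "(SOME l. bump l x \<noteq> 0) = k" by blast
  then show ?thesis by (simp add: superposition_def)
qed (simp add: superposition_def)

lemma superposition_cases:
  obtains "\<And>b. superposition b x = 0"
  | k where "x \<in> ball (a k) (radius k)" "\<And>b. superposition b x = b k * bump k x"
proof (cases "\<exists>k. bump k x \<noteq> 0")
  case True
  then obtain k where k: "bump k x \<noteq> 0" by blast
  have "superposition b x = b k * bump k x" for b
    by (rule superposition_eq) (rule bump_zero_on_other_ball[OF bump_nonzero_imp[OF k]])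
  then show thesis using that(2) bump_nonzero_imp[OF k] by blast
qed (simp add: superposition_def that(1))

lemma superposition_center: "superposition b (a k) = b k"
proof -
  have "superposition b (a k) = b k * bump k (a k)"
    by (rule superposition_eq) (rule bump_zero_on_other_ball, simp_all add: radius_bounds(1))
  then show ?thesis by (simp add: bump_center)
qed

lemma superposition_zero: "superposition (\<lambda>k. 0) x = 0"
  by (simp add: superposition_def)

lemma superposition_add:
  "superposition (\<lambda>k. b k + c k) x = superposition b x + superposition c x"
  by (simp add: superposition_def Let_def algebra_simps)

lemma superposition_scale:
  "superposition (\<lambda>k. r * b k) x = r * superposition b x"
  by (simp add: superposition_def Let_def)

text \<open>On a ball of radius \<open>1/2\<close> at most one bump is active.\<close>
lemma C_infinity_superposition: "C_infinity (superposition b)"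
proof (rule C_infinity_locally)
  fix x
  obtain k where k: "\<And>y l. y \<in> ball x (1/2) \<Longrightarrow> l \<noteq> k \<Longrightarrow> bump l y = 0"
  proof (cases "\<exists>y\<in>ball x (1/2). \<exists>k. bump k y \<noteq> 0")
    case True
    then obtain y k where y: "y \<in> ball x (1/2)" and k: "bump k y \<noteq> 0" by blast
    have "bump l z = 0" if "z \<in> ball x (1/2)" "l \<noteq> k" for z l
    proof (rule ccontr)
      assume "bump l z \<noteq> 0"
      moreover have "dist y z < 1"
        using y that(1) dist_triangle[of y z x] by (simp add: dist_commute)
      ultimately show False
        using balls_far_apart[OF bump_nonzero_imp[OF k] bump_nonzero_imp] that(2) by blast
    qed
    then show thesis by (rule that)
  qed (use that in blast)
  then have "\<forall>y\<in>ball x (1/2). superposition b y = b k * bump k y"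
    by (intro ballI superposition_eq) auto
  then show "\<exists>g U. C_infinity g \<and> open U \<and> x \<in> U \<and> (\<forall>y\<in>U. superposition b y = g y)"
    using C_infinity_bump[of "b k" k]
    by (intro exI[of _ "\<lambda>x. b k * bump k x"] exI[of _ "ball x (1/2)"]) simp
qed

text \<open>The dimension is at least 1 and the radius at most 1, so the radius itself bounds its powers.\<close>
lemma measure_ball_radius_le:
  "measure lborel (ball (a k) (radius k)) \<le> unit_ball_vol CARD('n) / 2 ^ k"
proof -
  have "radius k ^ CARD('n) \<le> radius k ^ 1"
    using radius_bounds[of k] by (intro power_decreasing) (auto simp: Suc_le_eq)
  also have "\<dots> \<le> 1 / 2 ^ k"
    by (simp add: radius_def power_one_over field_simps)
  finally have "unit_ball_vol CARD('n) * radius k ^ CARD('n) \<le> unit_ball_vol CARD('n) * (1 / 2 ^ k)"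
    by (rule mult_left_mono) simp
  then show ?thesis
    using radius_bounds(1)[of k] by (simp add: content_ball)
qed

text \<open>The function is dominated by the step function with value \<open>\<bar>b k\<bar> powr p\<close> on the \<open>k\<close>-th ball,
  whose integral is a series that the volume estimate makes convergent.\<close>
lemma integrable_superposition:
  assumes p: "p \<ge> 1" and b: "summable (\<lambda>k. \<bar>b k\<bar> powr p / 2 ^ k)"
  shows "integrable lborel (\<lambda>x. \<bar>superposition b x\<bar> powr p)"
proof (rule Bochner_Integration.integrable_bound)
  let ?I = "\<lambda>k. indicat_real (ball (a k) (radius k))"
  let ?g = "\<lambda>k x. \<bar>b k\<bar> powr p * ?I k x"
  have summable: "summable (\<lambda>k. ?g k x)" for x
  proof (cases "\<exists>k. x \<in> ball (a k) (radius k)")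
    case True
    then obtain k where k: "x \<in> ball (a k) (radius k)" by blast
    have "?g l x = 0" if "l \<notin> {k}" for l
    proof -
      have "x \<notin> ball (a l) (radius l)"
        using balls_far_apart[OF _ k, of x l] that by (auto simp del: mem_ball)
      then show ?thesis by (simp del: mem_ball)
    qed
    then show ?thesis by (rule summable_finite[rotated]) auto
  qed (simp add: indicator_def)
  have int: "(LINT x|lborel. ?g k x) = \<bar>b k\<bar> powr p * measure lborel (ball (a k) (radius k))" for k
    by simp
  show "integrable lborel (\<lambda>x. \<Sum>k. ?g k x)"
  proof (rule integrable_suminf)
    show "integrable lborel (?g k)" for k
      by (intro integrable_mult_right integrable_real_indicator emeasure_lborel_ball_finite) simp
    show "AE x in lborel. summable (\<lambda>k. norm (?g k x))"
      using summable by simp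
    have "summable (\<lambda>k. \<bar>b k\<bar> powr p * measure lborel (ball (a k) (radius k)))"
    proof (rule summable_comparison_test')
      show "summable (\<lambda>k. unit_ball_vol CARD('n) * (\<bar>b k\<bar> powr p / 2 ^ k))"
        using b by (rule summable_mult)
      show "norm (\<bar>b k\<bar> powr p * measure lborel (ball (a k) (radius k)))
          \<le> unit_ball_vol CARD('n) * (\<bar>b k\<bar> powr p / 2 ^ k)" for k
        using mult_left_mono[OF measure_ball_radius_le[of k], of "\<bar>b k\<bar> powr p"]
        by (simp add: mult_ac)
    qed
    then show "summable (\<lambda>k. LINT x|lborel. norm (?g k x))"
      by simp
  qed
  have [measurable]: "superposition b \<in> borel_measurable borel"
    by (intro borel_measurable_continuous_onI C_infinity_continuous C_infinity_superposition)
  show "(\<lambda>x. \<bar>superposition b x\<bar> powr p) \<in> borel_measurable lborel"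
    by measurable
  show "AE x in lborel. norm (\<bar>superposition b x\<bar> powr p) \<le> norm (\<Sum>k. ?g k x)"
  proof (rule AE_I2)
    fix x
    show "norm (\<bar>superposition b x\<bar> powr p) \<le> norm (\<Sum>k. ?g k x)"
    proof (cases rule: superposition_cases[of x])
      case (2 k)
      have "\<bar>superposition b x\<bar> powr p \<le> \<bar>b k\<bar> powr p"
        using p bump_bounds[of k x] 2(2)
        by (intro powr_mono2) (auto simp: abs_mult intro!: mult_left_le)
      also have "\<dots> = (\<Sum>k\<in>{k}. ?g k x)" using 2(1) by simp
      also have "\<dots> \<le> (\<Sum>k. ?g k x)"
        by (intro sum_le_suminf summable) auto
      finally show ?thesis by simp
    qed simp
  qed
qed

end

section \<open>The space of expansions\<close>

locale unbounded_along = escaping_sequence a for a :: "nat \<Rightarrow> real ^ 'n::finite" +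
  fixes f :: "'n X"
  assumes large: "real k < \<bar>fun_of f (a k)\<bar>"
begin

text \<open>The pairing function splits the indices into infinitely many infinite blocks;
  \<open>member n j\<close> below is the \<open>j\<close>-th index of block \<open>n\<close>.\<close>
definition block :: "nat \<Rightarrow> nat" where
  "block k = fst (prod_decode k)"

text \<open>Block 0 stays free of bumps: there an expansion is a multiple of \<open>f\<close>, which makes the
  coefficient of \<open>f\<close> recoverable and keeps \<open>f\<close> from being cancelled.\<close>
definition height :: "nat \<Rightarrow> real" where
  "height k = (if block k = 0 then 0 else real k + 1)"

definition member :: "nat \<Rightarrow> nat \<Rightarrow> nat" where
  "member n j = prod_encode (n, j)"

lemma block_member: "block (member n j) = n"
  by (simp add: block_def member_def)

lemma member_ge: "j \<le> member n j"
  by (simp add: member_def le_prod_encode_2)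

definition expansion :: "(nat \<Rightarrow> real) \<Rightarrow> real ^ 'n \<Rightarrow> real" where
  "expansion c x = c 0 * fun_of f x + superposition (\<lambda>k. c (block k) * height k) x"

lemma expansion_center:
  "expansion c (a k) = c 0 * fun_of f (a k) + c (block k) * height k"
  by (simp add: expansion_def superposition_center)

text \<open>Reads the coefficients off an expansion, using the first centre of block 0 to find the
  multiple of \<open>f\<close> and the first centre of block \<open>n\<close> for the rest. It is defined on all of \<open>X\<close>
  and uses only point values, hence it is linear and continuous.\<close>
definition coefficient :: "nat \<Rightarrow> 'n X \<Rightarrow> real" where
  "coefficient n h =
    (let c = fun_of h (a (member 0 0)) / fun_of f (a (member 0 0)); k = member n 0
     in if n = 0 then c else (fun_of h (a k) - c * fun_of f (a k)) / height k)"

lemma f_center_nonzero: "fun_of f (a k) \<noteq> 0"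
  using large[of k] by auto

lemma coefficient_expansion:
  assumes "\<And>x. fun_of h x = expansion c x"
  shows "coefficient n h = c n"
  using f_center_nonzero
  by (auto simp: coefficient_def Let_def assms expansion_center block_member height_def)

lemma linear_coefficient: "linear (coefficient n)"
  by (rule linearI)
    (simp_all add: coefficient_def Let_def plus_X.rep_eq scaleR_X.rep_eq
      add_divide_distrib diff_divide_distrib algebra_simps)

lemma continuous_coefficient: "continuous_on UNIV (coefficient n)"
  unfolding coefficient_def Let_def
  by (cases "n = 0") (auto intro!: continuous_intros continuous_eval
      simp: f_center_nonzero height_def block_member)

text \<open>Describing the expansions by an equation in \<open>h\<close>, instead of by the existence of a
  coefficient sequence, exhibits them as an intersection of kernels of continuous functionals.\<close>
definition expansions :: "'n X set" where
  "expansions = {h. \<forall>x. fun_of h x = expansion (\<lambda>n. coefficient n h) x}"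

lemma expansionsI:
  assumes "\<And>x. fun_of h x = expansion c x"
  shows "h \<in> expansions"
  using coefficient_expansion[OF assms] assms by (simp add: expansions_def)

lemma subspace_expansions: "subspace expansions"
proof (rule subspaceI)
  show "0 \<in> expansions"
    by (rule expansionsI[of _ "\<lambda>n. 0"]) (simp add: expansion_def zero_X.rep_eq superposition_zero)
  show "g + h \<in> expansions" if "g \<in> expansions" "h \<in> expansions" for g h
    using that
    by (intro expansionsI[of _ "\<lambda>n. coefficient n g + coefficient n h"])
      (simp add: expansions_def expansion_def plus_X.rep_eq superposition_add distrib_right)
  show "r *\<^sub>R h \<in> expansions" if "h \<in> expansions" for r h
    using that
    by (intro expansionsI[of _ "\<lambda>n. r * coefficient n h"])
      (simp add: expansions_def expansion_def scaleR_X.rep_eq superposition_scale mult.assoc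
        distrib_left)
qed

lemma closed_expansions: "closed expansions"
  unfolding expansions_def expansion_def superposition_def Let_def
  by (intro closed_Collect_all closed_Collect_eq continuous_intros continuous_eval
      continuous_coefficient)

lemma f_in_expansions: "f \<in> expansions"
proof -
  have "(\<lambda>k. (if block k = 0 then 1 else 0) * height k) = (\<lambda>k. 0)"
    by (auto simp: height_def)
  then show ?thesis
    by (intro expansionsI[of _ "\<lambda>n. if n = 0 then 1 else 0"])
      (simp add: expansion_def superposition_zero)
qed

text \<open>Bounded coefficients give heights of at most linear growth, against which the volumes of the
  supports decay exponentially.\<close>
lemma expansion_in_X:
  assumes "\<And>n. \<bar>c n\<bar> \<le> 1"
  obtains h where "\<And>x. fun_of h x = expansion c x"
proof -
  have le: "\<bar>c (block k) * height k\<bar> \<le> real k + 1" for k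
    using mult_mono[OF assms[of "block k"], of "\<bar>height k\<bar>" "real k + 1"]
    by (simp add: abs_mult height_def split: if_splits)
  have "integrable lborel (\<lambda>x. \<bar>expansion c x\<bar> powr p)" if p: "p \<ge> 1" for p
  proof -
    have "summable (\<lambda>k. \<bar>c (block k) * height k\<bar> powr p / 2 ^ k)"
    proof (rule summable_comparison_test'[OF summable_powr_div_exponential[of p]])
      show "norm (\<bar>c (block k) * height k\<bar> powr p / 2 ^ k) \<le> (real k + 1) powr p / 2 ^ k" for k
        using powr_mono2[OF _ _ le[of k], of p] p by (simp add: divide_right_mono)
    qed
    from integrable_superposition[OF p this] show ?thesis
      unfolding expansion_def
      using integrable_powr_lincomb[of "fun_of f" p "superposition (\<lambda>k. c (block k) * height k)" "c 0" 1] p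
      by (simp add: C_infinity_continuous fun_of_C_infinity fun_of_integrable C_infinity_superposition)
  qed
  moreover have "C_infinity (expansion c)"
    using C_infinity_lincomb[OF fun_of_C_infinity[of f] C_infinity_superposition, of "c 0" 1]
    by (simp add: expansion_def[abs_def])
  ultimately show thesis
    using that[of "Abs_X (expansion c)"] by (simp add: Abs_X_inverse)
qed

lemma dim_expansions: "has_algebraic_dim expansions |UNIV :: real set|"
proof -
  have "\<exists>h. \<forall>x. fun_of h x = expansion (\<lambda>n. t ^ n) x" if "0 < t" "t < 1" for t
  proof -
    have "\<bar>t ^ n\<bar> \<le> 1" for n using that by (simp add: power_le_one)
    from expansion_in_X[of "\<lambda>n. t ^ n", OF this] show ?thesis by blast
  qed
  then obtain e where e: "\<And>t x. 0 < t \<Longrightarrow> t < 1 \<Longrightarrow> fun_of (e t) x = expansion (\<lambda>n. t ^ n) x"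
    by metis
  show ?thesis
  proof (rule continuum_dim[OF subspace_expansions linear_coefficient])
    show "h = h'" if "h \<in> expansions" "h' \<in> expansions" "\<And>n. coefficient n h = coefficient n h'" for h h'
      using that by (simp add: expansions_def fun_of_inject[symmetric] fun_eq_iff)
    show "e t \<in> expansions" if "0 < t" "t < 1" for t
      using e[OF that] by (rule expansionsI)
    show "coefficient n (e t) = t ^ n" if "0 < t" "t < 1" for t n
      using e[OF that] by (rule coefficient_expansion)
  qed
qed

text \<open>Along one block, an expansion without \<open>f\<close> is a multiple of \<open>k + 1\<close>; with \<open>f\<close>, block 0
  serves, where it is a multiple of \<open>f\<close>.\<close>
lemma expansions_unbounded:
  assumes h: "h \<in> expansions" "h \<noteq> 0"
  shows "\<not> bounded (fun_of h ` range a)"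
proof
  let ?c = "\<lambda>n. coefficient n h"
  have val: "fun_of h (a k) = ?c 0 * fun_of f (a k) + ?c (block k) * height k" for k
    using h(1) by (simp add: expansions_def expansion_center)
  \<comment> \<open>Prefer block 0: on any other block the contributions of \<open>f\<close> and of the bumps could cancel.\<close>
  obtain n where n: "?c n \<noteq> 0" "?c 0 \<noteq> 0 \<Longrightarrow> n = 0"
  proof -
    have "\<exists>n. ?c n \<noteq> 0"
    proof (rule ccontr)
      assume "\<nexists>n. ?c n \<noteq> 0"
      then have "fun_of h x = 0" for x
        using h(1) by (simp add: expansions_def expansion_def superposition_zero)
      then show False
        using h(2) by (simp add: fun_of_inject[symmetric] zero_X.rep_eq fun_eq_iff)
    qed
    then show thesis using that by blast
  qed
  assume "bounded (fun_of h ` range a)"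
  then obtain M where M: "\<And>k. \<bar>fun_of h (a k)\<bar> \<le> M"
    by (auto simp: bounded_iff)
  obtain j :: nat where j: "M / \<bar>?c n\<bar> < real j"
    using reals_Archimedean2 by blast
  let ?k = "member n j"
  have "M < \<bar>?c n\<bar> * real j"
    using j n(1) by (simp add: field_simps)
  also have "\<dots> \<le> \<bar>?c n\<bar> * real ?k"
    using member_ge[of j n] by (intro mult_left_mono) auto
  also have "\<dots> \<le> \<bar>fun_of h (a ?k)\<bar>"
  proof (cases "n = 0")
    case True
    then show ?thesis
      using large[of ?k] by (auto simp: val block_member height_def abs_mult intro!: mult_left_mono)
  next
    case False
    with n(2) have "?c 0 = 0" by blast
    with False show ?thesis
      by (auto simp: val block_member height_def abs_mult intro!: mult_left_mono)
  qed
  finally show False using M[of ?k] by simp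
qed

end

text \<open>Continuity bounds \<open>f\<close> on every ball, so large values on \<open>A\<close> occur arbitrarily far out and
  the points can be chosen one after the other.\<close>
lemma escaping_sequence_exists:
  fixes f :: "real ^ 'n::finite \<Rightarrow> real"
  assumes cont: "continuous_on UNIV f" and unb: "\<not> bounded (f ` A)"
  obtains a where "range a \<subseteq> A" "\<And>k. real k < \<bar>f (a k)\<bar>" "\<And>k. norm (a k) + 2 \<le> norm (a (Suc k))"
proof -
  have far: "\<exists>x\<in>A. R \<le> norm x \<and> M < \<bar>f x\<bar>" for R M
  proof (rule ccontr)
    assume neg: "\<not> ?thesis"
    have "f ` A \<subseteq> f ` cball 0 R \<union> cball 0 M"
    proof
      fix y assume "y \<in> f ` A"
      then obtain x where "x \<in> A" "y = f x" by blast
      with neg show "y \<in> f ` cball 0 R \<union> cball 0 M"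
        by (cases "norm x \<le> R") (auto simp: not_le not_less)
    qed
    moreover have "compact (f ` cball 0 R)"
      using cont by (intro compact_continuous_image) (auto intro: continuous_on_subset)
    ultimately show False
      using unb by (meson bounded_Un bounded_cball bounded_subset compact_imp_bounded)
  qed
  have "\<exists>a. \<forall>k. (a k \<in> A \<and> real k < \<bar>f (a k)\<bar>) \<and> norm (a k) + 2 \<le> norm (a (Suc k))"
    by (rule dependent_nat_choice) (use far in blast)+
  then show thesis using that by blast
qed

theorem theorem3p2:
  fixes A :: "(real ^ 'n::finite) set"
  assumes "\<not> compact (closure A)"
  shows "pointwise_spaceable |UNIV :: real set| (nBC_infty_I A)"
  unfolding pointwise_spaceable_def
proof
  fix f :: "'n X" assume "f \<in> nBC_infty_I A"
  then have "\<not> bounded (fun_of f ` A)"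
    by (simp add: nBC_infty_I_def)
  then obtain a where a: "range a \<subseteq> A" "\<And>k. real k < \<bar>fun_of f (a k)\<bar>"
    "\<And>k. norm (a k) + 2 \<le> norm (a (Suc k))"
    using escaping_sequence_exists[OF C_infinity_continuous[OF fun_of_C_infinity]] by blast
  interpret unbounded_along a f
    by standard (use a in auto)
  have "expansions \<subseteq> nBC_infty_I A \<union> {0}"
  proof
    fix h assume "h \<in> expansions"
    then have "h \<noteq> 0 \<Longrightarrow> \<not> bounded (fun_of h ` A)"
      using expansions_unbounded bounded_subset[OF _ image_mono[OF a(1)]] by blast
    then show "h \<in> nBC_infty_I A \<union> {0}"
      by (auto simp: nBC_infty_I_def)
  qed
  then show "\<exists>W. subspace W \<and> closed W \<and> has_algebraic_dim W |UNIV :: real set| \<and>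
      f \<in> W \<and> W \<subseteq> nBC_infty_I A \<union> {0}"
    using subspace_expansions closed_expansions dim_expansions f_in_expansions by blast
qed

end
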